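(* Let $f:[0,\infty)\to\mathbb R$. The following conditions (1)–(4) are equivalent, and each of (1), (2), (3) is also equivalent to its Max counterpart stated with it: 1. For every $n\ge1$ and every $A\in\mathcal C_{\min,n}$, the matrix $f[A]$ is positive semidefinite. (Max counterpart: for every $n\ge1$ and every $A\in\mathcal C_{\max,n}$, $f[A]$ is positive semidefinite.) 2. For every $n\ge1$ and every $A\in\mathcal C_{\min,n}$, the matrix $f[A]$ is totally nonnegative. (Max counterpart: for every $n\ge1$ and every $A\in\mathcal C_{\max,n}$, $f[A]$ is totally nonnegative.) 3. For every $n\ge1$ and every $A\in\mathcal C_{\min,n}$, one has $f[A]\in\mathcal C_{\min,n}$. (Max counterpart: for every $n\ge1$ and every $A\in\mathcal C_{\max,n}$, one has $f[A]\in\mathcal C_{\max,n}$.) 4. $f(t)\ge0$ for all $t\ge0$, and $f$ is nondecreasing on $[0,\infty)$.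
   Context: For $x=(x_1,\ldots,x_n)\in\mathbb R^n$, define the $n\times n$ real symmetric matrices $A_{\min}(x)=\bigl(x_{\min(i,j)}\bigr)_{i,j=1}^n$ and $A_{\max}(x)=\bigl(x_{\max(i,j)}\bigr)_{i,j=1}^n$. Set $\mathcal C_{\min,n}=\{A_{\min}(x):0\le x_1\le x_2\le\cdots\le x_n\}$ and $\mathcal C_{\max,n}=\{A_{\max}(x):x_1\ge x_2\ge\cdots\ge x_n\ge0\}$. For $f:[0,\infty)\to\mathbb R$ and a matrix $A=(a_{ij})$ with entries in $[0,\infty)$, $f[A]=(f(a_{ij}))$ is the entrywise image. A real matrix is totally nonnegative if all of its minors (of all orders) are nonnegative. *)

theory Defs
  imports "Jordan_Normal_Form.Determinant" "Jordan_Normal_Form.DL_Submatrix"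
begin

text \<open>
  Vectors and matrices are indexed from 0, so the mathematical \<open>x\<^sub>1, \<dots>, x\<^sub>n\<close> are
  \<open>x $ 0, \<dots>, x $ (n - 1)\<close>. Since the shift commutes with \<open>min\<close> and \<open>max\<close>,
  the matrices below are the usual ones. The entrywise image \<open>f[A]\<close> is \<open>map_mat f A\<close>.
\<close>

definition A_min :: "real vec \<Rightarrow> real mat" where
  "A_min x = mat (dim_vec x) (dim_vec x) (\<lambda>(i, j). x $ min i j)"

definition A_max :: "real vec \<Rightarrow> real mat" where
  "A_max x = mat (dim_vec x) (dim_vec x) (\<lambda>(i, j). x $ max i j)"

definition C_min :: "nat \<Rightarrow> real mat set" where
  "C_min n = {A_min x | x. x \<in> carrier_vec n \<and> (\<forall>i<n. 0 \<le> x $ i) \<and>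
     (\<forall>i j. i \<le> j \<and> j < n \<longrightarrow> x $ i \<le> x $ j)}"

definition C_max :: "nat \<Rightarrow> real mat set" where
  "C_max n = {A_max x | x. x \<in> carrier_vec n \<and> (\<forall>i<n. 0 \<le> x $ i) \<and>
     (\<forall>i j. i \<le> j \<and> j < n \<longrightarrow> x $ j \<le> x $ i)}"

definition pos_semidef :: "real mat \<Rightarrow> bool" where
  "pos_semidef A \<longleftrightarrow> square_mat A \<and> transpose_mat A = A \<and>
     (\<forall>v \<in> carrier_vec (dim_row A). 0 \<le> v \<bullet> (A *\<^sub>v v))"

text \<open>
  \<open>submatrix A I J\<close> lists the selected rows and columns in increasing order, so its
  determinant is the minor of \<open>A\<close> with row set \<open>I\<close> and column set \<open>J\<close>.
\<close>

definition totally_nonneg :: "real mat \<Rightarrow> bool" where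
  "totally_nonneg A \<longleftrightarrow>
     (\<forall>I J. I \<subseteq> {..<dim_row A} \<and> J \<subseteq> {..<dim_col A} \<and> I \<noteq> {} \<and> card I = card J
        \<longrightarrow> 0 \<le> det (submatrix A I J))"

end

theory Submission
  imports Defs
begin

text \<open>
  If \<open>x\<close> is increasing, then \<open>x\<^bsub>min(i,j)\<^esub> = min (x\<^sub>i) (x\<^sub>j)\<close>; if \<open>x\<close> is decreasing, then
  \<open>x\<^bsub>max(i,j)\<^esub> = min (x\<^sub>i) (x\<^sub>j)\<close>. An index operation on the entries becomes an operation on their values. So
  both classes consist of matrices \<open>(min (a\<^sub>i) (a\<^sub>j))\<close> with \<open>a \<ge> 0\<close>, where \<open>a\<close> is increasing for the
  one class and decreasing for the other. A nondecreasing nonnegative \<open>f\<close> commutes with minima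
  (\<open>map_min_matrix\<close>) and preserves the sign and the direction of \<open>a\<close>, and hence preserves each class.

  Preserving a class implies the two positivity properties, because every member of it has them.
  Positive semidefiniteness of \<open>(min (a\<^sub>i) (a\<^sub>j))\<close> holds for every \<open>a \<ge> 0\<close>: the smallest
  \<open>a\<^sub>k\<close> splits off as \<open>a\<^sub>k\<close> times the square of a sum, and leaves a form of the same kind in
  fewer variables (\<open>min_form_nonneg\<close>). A minor of such a matrix has the shape
  \<open>det (min (a\<^sub>i) (b\<^sub>j))\<close> with \<open>a\<close> and \<open>b\<close> monotone in the same direction. For increasing
  sequences its last two rows, or its last two columns, agree except in the corner, so it is a
  nonnegative multiple of the minor one size smaller (\<open>det_min_matrix_nonneg\<close>). Decreasing
  sequences follow by reversing the order of the rows and of the columns.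

  Conversely, for \<open>0 \<le> s \<le> t\<close> each class contains a matrix of order two with diagonal entries \<open>s\<close>
  and \<open>t\<close> and both other entries equal to \<open>s\<close>. Either positivity property of its image
  gives \<open>f s \<ge> 0\<close> and \<open>f s \<le> f t\<close>, which closes the circle (\<open>preserver_equivalences\<close>).
\<close>

section \<open>Matrices of minima\<close>

text \<open>
  The two sequences are kept apart because a minor selects rows and columns independently.
\<close>

definition min_matrix :: "nat \<Rightarrow> (nat \<Rightarrow> real) \<Rightarrow> (nat \<Rightarrow> real) \<Rightarrow> real mat" where
  "min_matrix n a b = mat n n (\<lambda>(i, j). min (a i) (b j))"

lemma min_matrix_carrier [simp]: "min_matrix n a b \<in> carrier_mat n n"
  by (simp add: min_matrix_def)

lemma dim_min_matrix [simp]: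
  "dim_row (min_matrix n a b) = n" "dim_col (min_matrix n a b) = n"
  by (simp_all add: min_matrix_def)

lemma index_min_matrix [simp]:
  "i < n \<Longrightarrow> j < n \<Longrightarrow> min_matrix n a b $$ (i, j) = min (a i) (b j)"
  by (simp add: min_matrix_def)

lemma transpose_min_matrix: "transpose_mat (min_matrix n a b) = min_matrix n b a"
  by (intro eq_matI) (auto simp: min.commute)

lemma C_min_eq_min_matrices:
  "C_min n = {min_matrix n a a | a. (\<forall>i<n. 0 \<le> a i) \<and> mono_on {..<n} a}" (is "_ = ?R")
proof (intro equalityI subsetI)
  fix A assume "A \<in> C_min n"
  then obtain x where x: "A = A_min x" "x \<in> carrier_vec n" "\<forall>i<n. 0 \<le> x $ i"
    and m: "\<forall>i j. i \<le> j \<and> j < n \<longrightarrow> x $ i \<le> x $ j"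
    by (auto simp: C_min_def)
  have mono: "mono_on {..<n} (\<lambda>i. x $ i)" using m by (auto intro: mono_onI)
  have "A = min_matrix n (\<lambda>i. x $ i) (\<lambda>i. x $ i)"
  proof (intro eq_matI)
    fix i j assume "i < dim_row (min_matrix n (\<lambda>i. x $ i) (\<lambda>i. x $ i))"
      "j < dim_col (min_matrix n (\<lambda>i. x $ i) (\<lambda>i. x $ i))"
    hence ij: "i < n" "j < n" by auto
    with m have "i \<le> j \<Longrightarrow> x $ i \<le> x $ j" "j \<le> i \<Longrightarrow> x $ j \<le> x $ i" by auto
    with ij x show "A $$ (i, j) = min_matrix n (\<lambda>i. x $ i) (\<lambda>i. x $ i) $$ (i, j)"
      by (cases "i \<le> j") (auto simp: A_min_def min_def)
  qed (use x in \<open>auto simp: A_min_def\<close>)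
  with x mono show "A \<in> ?R" by blast
next
  fix A assume "A \<in> ?R"
  then obtain a where a: "A = min_matrix n a a" "\<forall>i<n. 0 \<le> a i"
    and m: "mono_on {..<n} a" by auto
  have "A = A_min (vec n a)"
  proof (intro eq_matI)
    fix i j assume "i < dim_row (A_min (vec n a))" "j < dim_col (A_min (vec n a))"
    hence ij: "i < n" "j < n" by (auto simp: A_min_def)
    have "i \<le> j \<Longrightarrow> a i \<le> a j" "j \<le> i \<Longrightarrow> a j \<le> a i" using ij mono_onD[OF m, of i j] mono_onD[OF m, of j i] by auto
    with ij a show "A $$ (i, j) = A_min (vec n a) $$ (i, j)"
      by (cases "i \<le> j") (auto simp: A_min_def min_def)
  qed (use a in \<open>auto simp: A_min_def\<close>)
  moreover have "\<forall>i j. i \<le> j \<and> j < n \<longrightarrow> vec n a $ i \<le> vec n a $ j"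
    using mono_onD[OF m] by auto
  ultimately show "A \<in> C_min n"
    unfolding C_min_def using a by (intro CollectI exI[of _ "vec n a"]) auto
qed

lemma C_max_eq_min_matrices:
  "C_max n = {min_matrix n a a | a. (\<forall>i<n. 0 \<le> a i) \<and> antimono_on {..<n} a}" (is "_ = ?R")
proof (intro equalityI subsetI)
  fix A assume "A \<in> C_max n"
  then obtain x where x: "A = A_max x" "x \<in> carrier_vec n" "\<forall>i<n. 0 \<le> x $ i"
    and m: "\<forall>i j. i \<le> j \<and> j < n \<longrightarrow> x $ j \<le> x $ i"
    by (auto simp: C_max_def)
  have mono: "antimono_on {..<n} (\<lambda>i. x $ i)" using m by (auto intro: monotone_onI)
  have "A = min_matrix n (\<lambda>i. x $ i) (\<lambda>i. x $ i)"
  proof (intro eq_matI)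
    fix i j assume "i < dim_row (min_matrix n (\<lambda>i. x $ i) (\<lambda>i. x $ i))"
      "j < dim_col (min_matrix n (\<lambda>i. x $ i) (\<lambda>i. x $ i))"
    hence ij: "i < n" "j < n" by auto
    with m have "i \<le> j \<Longrightarrow> x $ j \<le> x $ i" "j \<le> i \<Longrightarrow> x $ i \<le> x $ j" by auto
    with ij x show "A $$ (i, j) = min_matrix n (\<lambda>i. x $ i) (\<lambda>i. x $ i) $$ (i, j)"
      by (cases "i \<le> j") (auto simp: A_max_def min_def max_def)
  qed (use x in \<open>auto simp: A_max_def\<close>)
  with x mono show "A \<in> ?R" by blast
next
  fix A assume "A \<in> ?R"
  then obtain a where a: "A = min_matrix n a a" "\<forall>i<n. 0 \<le> a i"
    and m: "antimono_on {..<n} a" by auto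
  have "A = A_max (vec n a)"
  proof (intro eq_matI)
    fix i j assume "i < dim_row (A_max (vec n a))" "j < dim_col (A_max (vec n a))"
    hence ij: "i < n" "j < n" by (auto simp: A_max_def)
    have "i \<le> j \<Longrightarrow> a j \<le> a i" "j \<le> i \<Longrightarrow> a i \<le> a j" using ij monotone_onD[OF m, of i j] monotone_onD[OF m, of j i] by auto
    with ij a show "A $$ (i, j) = A_max (vec n a) $$ (i, j)"
      by (cases "i \<le> j") (auto simp: A_max_def min_def max_def)
  qed (use a in \<open>auto simp: A_max_def\<close>)
  moreover have "\<forall>i j. i \<le> j \<and> j < n \<longrightarrow> vec n a $ j \<le> vec n a $ i"
    using monotone_onD[OF m] by auto
  ultimately show "A \<in> C_max n"
    unfolding C_max_def using a by (intro CollectI exI[of _ "vec n a"]) auto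
qed

lemma map_min_matrix:
  assumes "mono_on {0..} f" and "\<And>i. i < n \<Longrightarrow> 0 \<le> a i"
  shows "map_mat f (min_matrix n a a) = min_matrix n (f \<circ> a) (f \<circ> a)"
proof (intro eq_matI)
  fix i j assume "i < dim_row (min_matrix n (f \<circ> a) (f \<circ> a))"
    "j < dim_col (min_matrix n (f \<circ> a) (f \<circ> a))"
  hence ij: "i < n" "j < n" by auto
  have "a i \<le> a j \<Longrightarrow> f (a i) \<le> f (a j)" "a j \<le> a i \<Longrightarrow> f (a j) \<le> f (a i)"
    using assms ij by (auto intro: mono_onD)
  with ij show "map_mat f (min_matrix n a a) $$ (i, j) = min_matrix n (f \<circ> a) (f \<circ> a) $$ (i, j)"
    by (cases "a i \<le> a j") (auto simp: min_def)
qed auto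

section \<open>Positive semidefiniteness\<close>

text \<open>
  With \<open>a\<^sub>k\<close> minimal, \<open>min (a\<^sub>i) (a\<^sub>j) = a\<^sub>k + min (a\<^sub>i - a\<^sub>k) (a\<^sub>j - a\<^sub>k)\<close>. The constant contributes
  \<open>a\<^sub>k (\<Sum>v\<^sub>i)\<^sup>2\<close>, and the remaining kernel vanishes in row and column \<open>k\<close>, so that the index \<open>k\<close>
  can be dropped.
\<close>

lemma min_form_nonneg:
  fixes a v :: "'i \<Rightarrow> real"
  assumes "finite S" "\<And>i. i \<in> S \<Longrightarrow> 0 \<le> a i"
  shows "0 \<le> (\<Sum>i\<in>S. \<Sum>j\<in>S. min (a i) (a j) * (v i * v j))"
  using assms
proof (induction S arbitrary: a rule: finite_psubset_induct)
  case (psubset S)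
  show ?case
  proof (cases "S = {}")
    case False
    obtain k where k: "k \<in> S" "\<And>i. i \<in> S \<Longrightarrow> a k \<le> a i"
      using arg_min_if_finite[of S a] psubset.hyps False by (metis not_le)
    define b where "b i = a i - a k" for i
    have b: "0 \<le> b i" if "i \<in> S" for i using k(2)[OF that] by (simp add: b_def)
    have bk: "b k = 0" by (simp add: b_def)
    have "(\<Sum>i\<in>S. \<Sum>j\<in>S. min (a i) (a j) * (v i * v j))
        = (\<Sum>i\<in>S. \<Sum>j\<in>S. a k * (v i * v j) + min (b i) (b j) * (v i * v j))"
      by (intro sum.cong refl) (auto simp: b_def min_def algebra_simps)
    also have "\<dots> = a k * (sum v S)\<^sup>2 + (\<Sum>i\<in>S. \<Sum>j\<in>S. min (b i) (b j) * (v i * v j))"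
      unfolding power2_eq_square sum_product by (simp add: sum.distrib sum_distrib_left)
    also have "(\<Sum>i\<in>S. \<Sum>j\<in>S. min (b i) (b j) * (v i * v j))
        = (\<Sum>i\<in>S - {k}. \<Sum>j\<in>S - {k}. min (b i) (b j) * (v i * v j))"
      using psubset.hyps k(1) b bk
      by (simp add: sum.remove[of S k])
    also have "a k * (sum v S)\<^sup>2 + \<dots> \<ge> 0"
      using psubset.IH[of "S - {k}" b] b psubset.prems k(1)
      by (intro add_nonneg_nonneg mult_nonneg_nonneg) auto
    finally show ?thesis .
  qed simp
qed

lemma pos_semidef_min_matrix:
  assumes "\<And>i. i < n \<Longrightarrow> 0 \<le> a i"
  shows "pos_semidef (min_matrix n a a)"
  unfolding pos_semidef_def
proof (intro conjI ballI)
  fix v :: "real vec" assume v: "v \<in> carrier_vec (dim_row (min_matrix n a a))"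
  have "v \<bullet> (min_matrix n a a *\<^sub>v v)
      = (\<Sum>i\<in>{0..<n}. \<Sum>j\<in>{0..<n}. min (a i) (a j) * (v $ i * v $ j))"
    using v by (auto simp: scalar_prod_def sum_distrib_left mult_ac intro!: sum.cong)
  also have "\<dots> \<ge> 0" using assms by (intro min_form_nonneg) auto
  finally show "0 \<le> v \<bullet> (min_matrix n a a *\<^sub>v v)" .
qed (auto simp: transpose_min_matrix)

section \<open>Total nonnegativity\<close>

text \<open>
  Subtracting the last row but one from the last row leaves a single entry there, in the corner, and
  the determinant expands along it.
\<close>

lemma det_last_rows_agree:
  fixes A :: "'a :: comm_ring_1 mat"
  assumes A: "A \<in> carrier_mat (Suc (Suc m)) (Suc (Suc m))"
    and eq: "\<And>j. j < Suc m \<Longrightarrow> A $$ (Suc m, j) = A $$ (m, j)"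
  shows "det A = (A $$ (Suc m, Suc m) - A $$ (m, Suc m))
    * det (mat (Suc m) (Suc m) (\<lambda>(i, j). A $$ (i, j)))"
proof -
  define B where "B = addrow (-1) (Suc m) m A"
  have B: "B \<in> carrier_mat (Suc (Suc m)) (Suc (Suc m))" using A by (auto simp: B_def)
  have row: "B $$ (Suc m, j) = A $$ (Suc m, j) - A $$ (m, j)" if "j < Suc (Suc m)" for j
    using that A by (auto simp: B_def)
  have del: "mat_delete B (Suc m) (Suc m) = mat (Suc m) (Suc m) (\<lambda>(i, j). A $$ (i, j))"
    using A by (intro eq_matI) (auto simp: mat_delete_def B_def)
  have "det A = det B"
    unfolding B_def by (rule det_addrow[symmetric, OF _ _ A]) auto
  also have "\<dots> = (\<Sum>j<Suc (Suc m). B $$ (Suc m, j) * cofactor B (Suc m) j)"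
    by (rule laplace_expansion_row[OF B]) simp
  also have "\<dots> = B $$ (Suc m, Suc m) * cofactor B (Suc m) (Suc m)"
    using row eq by simp
  finally show ?thesis by (simp add: row cofactor_def del)
qed

text \<open>
  Let \<open>m\<close> be the last index but one. If \<open>b\<^sub>m \<le> a\<^sub>m\<close>, then every \<open>b\<^sub>j\<close> with \<open>j \<le> m\<close> is at most
  \<open>a\<^sub>m \<le> a\<^bsub>m+1\<^esub>\<close>, so in these columns both of the last two rows have the entry \<open>b\<^sub>j\<close>. In
  the last column the entry does not decrease from row \<open>m\<close> to row \<open>m + 1\<close>, which makes the factor in front
  of the smaller determinant nonnegative. If \<open>a\<^sub>m \<le> b\<^sub>m\<close>, transposition exchanges \<open>a\<close> and \<open>b\<close>.
\<close>

lemma det_min_matrix_nonneg: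
  assumes "mono_on {..<m} a" "mono_on {..<m} b"
    and "\<And>i. i < m \<Longrightarrow> 0 \<le> a i" "\<And>i. i < m \<Longrightarrow> 0 \<le> b i"
  shows "0 \<le> det (min_matrix m a b)"
  using assms
proof (induction m arbitrary: a b)
  case 0
  then show ?case by (simp add: det_dim_zero)
next
  case (Suc k)
  show ?case
  proof (cases k)
    case 0
    with Suc.prems(3,4)[of 0] show ?thesis
      by (simp add: det_single[of "min_matrix (Suc 0) a b"])
  next
    case (Suc m)
    have step: "0 \<le> det (min_matrix (Suc (Suc m)) a b)"
      if mono: "mono_on {..<Suc (Suc m)} a" "mono_on {..<Suc (Suc m)} b"
        and le: "b m \<le> a m" and IH: "0 \<le> det (min_matrix (Suc m) a b)" for a b
    proof -
      have am: "a m \<le> a (Suc m)" using mono(1) by (auto intro: mono_onD)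
      have "b j \<le> a m" if "j < Suc m" for j
        using mono_onD[OF mono(2), of j m] that le by auto
      hence rows: "min (a (Suc m)) (b j) = min (a m) (b j)" if "j < Suc m" for j
        using that am by (fastforce simp: min_def)
      have sub: "mat (Suc m) (Suc m) (\<lambda>(i, j). min_matrix (Suc (Suc m)) a b $$ (i, j))
          = min_matrix (Suc m) a b"
        by (intro eq_matI) auto
      have "det (min_matrix (Suc (Suc m)) a b)
          = (min (a (Suc m)) (b (Suc m)) - min (a m) (b (Suc m))) * det (min_matrix (Suc m) a b)"
        using det_last_rows_agree[of "min_matrix (Suc (Suc m)) a b" m, unfolded sub] rows
        by simp
      also have "\<dots> \<ge> 0" using am IH by (intro mult_nonneg_nonneg) auto
      finally show ?thesis .
    qed
    have IH: "0 \<le> det (min_matrix (Suc m) a b)"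
      using Suc.prems Suc by (intro Suc.IH[unfolded Suc]) (auto intro: mono_on_subset)
    have tr: "det (min_matrix n b a) = det (min_matrix n a b)" for n
      using det_transpose[of "min_matrix n a b" n] by (simp add: transpose_min_matrix)
    show ?thesis
      using step[of a b] step[of b a] Suc.prems(1,2) IH unfolding Suc tr
      by (cases "b m \<le> a m") auto
  qed
qed

text \<open>
  Rows and columns are permuted by the same permutation, so its sign occurs twice and cancels.
\<close>

lemma det_reverse_rows_cols:
  fixes A :: "'a :: comm_ring_1 mat"
  assumes A: "A \<in> carrier_mat n n"
  shows "det (mat n n (\<lambda>(i, j). A $$ (n - Suc i, n - Suc j))) = det A"
proof -
  define p where "p i = (if i < n then n - Suc i else i)" for i
  have p: "p permutes {0..<n}"
    by (rule bij_imp_permutes, rule bij_betw_byWitness[where f' = p]) (auto simp: p_def)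
  define R where "R M = mat n n (\<lambda>(i, j). M $$ (p i, j))" for M :: "'a mat"
  have R: "R M \<in> carrier_mat n n" for M by (simp add: R_def)
  \<comment> \<open>The column permutation is a row permutation of the transpose.\<close>
  have det_R: "det (R M) = signof p * det M" if "M \<in> carrier_mat n n" for M
    unfolding R_def by (rule det_permute_rows[OF that p])
  have "mat n n (\<lambda>(i, j). A $$ (n - Suc i, n - Suc j)) = R (transpose_mat (R (transpose_mat A)))"
    using A by (intro eq_matI) (auto simp: R_def p_def)
  also have "det \<dots> = signof p * (signof p * det A)"
    using A R by (simp add: det_R det_transpose[of _ n])
  also have "\<dots> = det A" by (simp add: sign_def)
  finally show ?thesis .
qed

lemma det_min_matrix_nonneg_antimono:
  assumes "antimono_on {..<m} a" "antimono_on {..<m} b"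
    and "\<And>i. i < m \<Longrightarrow> 0 \<le> a i" "\<And>i. i < m \<Longrightarrow> 0 \<le> b i"
  shows "0 \<le> det (min_matrix m a b)"
proof -
  have "0 \<le> det (min_matrix m (\<lambda>i. a (m - Suc i)) (\<lambda>i. b (m - Suc i)))"
    using assms(3,4)
    by (intro det_min_matrix_nonneg mono_onI monotone_onD[OF assms(1)] monotone_onD[OF assms(2)]) auto
  also have "min_matrix m (\<lambda>i. a (m - Suc i)) (\<lambda>i. b (m - Suc i))
      = mat m m (\<lambda>(i, j). min_matrix m a b $$ (m - Suc i, m - Suc j))"
    by (intro eq_matI) auto
  finally show ?thesis by (simp add: det_reverse_rows_cols)
qed

text \<open>
  A submatrix of a matrix of minima is again one, for the sequences restricted to the selected rows
  and columns; enumerating these in increasing order is what makes \<open>p\<close> and \<open>q\<close> strictly increasing.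
\<close>

lemma totally_nonneg_min_matrixI:
  assumes "\<And>m p q. strict_mono_on {..<m} p \<Longrightarrow> strict_mono_on {..<m} q \<Longrightarrow>
      p ` {..<m} \<subseteq> {..<n} \<Longrightarrow> q ` {..<m} \<subseteq> {..<n} \<Longrightarrow>
      0 \<le> det (min_matrix m (a \<circ> p) (b \<circ> q))"
  shows "totally_nonneg (min_matrix n a b)"
  unfolding totally_nonneg_def
proof (intro allI impI, elim conjE)
  fix I J
  assume "I \<subseteq> {..<dim_row (min_matrix n a b)}" "J \<subseteq> {..<dim_col (min_matrix n a b)}"
    and card: "card I = card J"
  hence I: "I \<subseteq> {..<n}" and J: "J \<subseteq> {..<n}" by auto
  have pick: "strict_mono_on {..<card K} (pick K)" "pick K ` {..<card K} \<subseteq> K" for K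
    by (auto intro!: strict_mono_onI pick_mono_le pick_in_set_le)
  have sets: "{i. i < n \<and> i \<in> I} = I" "{j. j < n \<and> j \<in> J} = J" using I J by auto
  have "pick I i < n" "pick J i < n" if "i < card J" for i
    using pick[of I] pick[of J] I J that card by fastforce+
  hence "submatrix (min_matrix n a b) I J
      = min_matrix (card J) (a \<circ> pick I) (b \<circ> pick J)"
    unfolding submatrix_def by (intro eq_matI) (auto simp: sets card)
  moreover have "0 \<le> det \<dots>"
    using pick[of I] pick[of J] I J card by (intro assms) auto
  ultimately show "0 \<le> det (submatrix (min_matrix n a b) I J)" by simp
qed

lemma totally_nonneg_min_matrix_mono:
  assumes "mono_on {..<n} a" "\<And>i. i < n \<Longrightarrow> 0 \<le> a i"
  shows "totally_nonneg (min_matrix n a a)"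
proof (rule totally_nonneg_min_matrixI)
  fix m and p q :: "nat \<Rightarrow> nat"
  assume pq: "strict_mono_on {..<m} p" "strict_mono_on {..<m} q"
    "p ` {..<m} \<subseteq> {..<n}" "q ` {..<m} \<subseteq> {..<n}"
  have "mono_on {..<m} (a \<circ> r)" if "strict_mono_on {..<m} r" "r ` {..<m} \<subseteq> {..<n}" for r
    using assms(1) strict_mono_on_imp_mono_on[OF that(1)] that(2) by (rule monotone_on_o)
  then show "0 \<le> det (min_matrix m (a \<circ> p) (a \<circ> q))"
    using pq assms(2) by (intro det_min_matrix_nonneg) auto
qed

lemma totally_nonneg_min_matrix_antimono:
  assumes "antimono_on {..<n} a" "\<And>i. i < n \<Longrightarrow> 0 \<le> a i"
  shows "totally_nonneg (min_matrix n a a)"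
proof (rule totally_nonneg_min_matrixI)
  fix m and p q :: "nat \<Rightarrow> nat"
  assume pq: "strict_mono_on {..<m} p" "strict_mono_on {..<m} q"
    "p ` {..<m} \<subseteq> {..<n}" "q ` {..<m} \<subseteq> {..<n}"
  have "antimono_on {..<m} (a \<circ> r)" if "strict_mono_on {..<m} r" "r ` {..<m} \<subseteq> {..<n}" for r
    using assms(1) strict_mono_on_imp_mono_on[OF that(1)] that(2) by (rule monotone_on_o)
  then show "0 \<le> det (min_matrix m (a \<circ> p) (a \<circ> q))"
    using pq assms(2) by (intro det_min_matrix_nonneg_antimono) auto
qed

section \<open>Necessity from matrices of order two\<close>

text \<open>
  The third inequality is the value of the quadratic form at \<open>(1, -1)\<close>. On the test matrices it is
  linear in \<open>f\<close> and reads \<open>2 * f s \<le> f s + f t\<close>.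
\<close>

lemma pos_semidef_2:
  assumes B: "B \<in> carrier_mat 2 2" and psd: "pos_semidef B"
  shows "0 \<le> B $$ (0, 0)" "0 \<le> B $$ (1, 1)"
    "B $$ (0, 1) + B $$ (1, 0) \<le> B $$ (0, 0) + B $$ (1, 1)"
proof -
  have form: "0 \<le> x * (B $$ (0, 0) * x + B $$ (0, 1) * y) + y * (B $$ (1, 0) * x + B $$ (1, 1) * y)"
    for x y
  proof -
    define v where "v = vec 2 (\<lambda>i. if i = 0 then x else y)"
    have dims: "dim_row B = 2" "dim_col B = 2" "dim_vec v = 2" using B by (auto simp: v_def)
    have entries: "v $ 0 = x" "v $ Suc 0 = y" by (auto simp: v_def)
    have "v \<in> carrier_vec (dim_row B)" by (intro carrier_vecI) (simp only: dims)
    with psd have "0 \<le> v \<bullet> (B *\<^sub>v v)" unfolding pos_semidef_def by blast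
    also have "v \<bullet> (B *\<^sub>v v) = (\<Sum>i<2. v $ i * (\<Sum>j<2. B $$ (i, j) * v $ j))"
      unfolding scalar_prod_def by (simp add: dims scalar_prod_def atLeast0LessThan)
    finally show ?thesis by (simp add: eval_nat_numeral lessThan_Suc entries algebra_simps)
  qed
  show "0 \<le> B $$ (0, 0)" "0 \<le> B $$ (1, 1)"
    "B $$ (0, 1) + B $$ (1, 0) \<le> B $$ (0, 0) + B $$ (1, 1)"
    using form[of 1 0] form[of 0 1] form[of 1 "-1"] by simp_all
qed

lemma det_2:
  fixes A :: "'a :: comm_ring_1 mat"
  assumes A: "A \<in> carrier_mat 2 2"
  shows "det A = A $$ (0, 0) * A $$ (1, 1) - A $$ (0, 1) * A $$ (1, 0)"
proof -
  have minor: "det (mat_delete A 0 j) = A $$ (1, 1 - j)" if "j < 2" for j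
    using that A by (subst det_single) (auto simp: mat_delete_def less_2_cases_iff)
  have "det A = (\<Sum>j<2. A $$ (0, j) * cofactor A 0 j)"
    by (rule laplace_expansion_row[OF A]) simp
  then show ?thesis
    using minor[of 0] minor[of 1] by (simp add: eval_nat_numeral lessThan_Suc cofactor_def)
qed

lemma totally_nonneg_2:
  assumes B: "B \<in> carrier_mat 2 2" and tn: "totally_nonneg B"
  shows "0 \<le> B $$ (0, 0)" "0 \<le> B $$ (1, 1)"
    "B $$ (0, 1) * B $$ (1, 0) \<le> B $$ (0, 0) * B $$ (1, 1)"
proof -
  have diag: "0 \<le> B $$ (k, k)" if "k < 2" for k
  proof -
    have set: "{i. i < 2 \<and> i \<in> {k}} = {k}" using that by auto
    have "0 \<le> det (submatrix B {k} {k})"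
      using tn B that unfolding totally_nonneg_def by auto
    moreover have "submatrix B {k} {k} \<in> carrier_mat 1 1"
      using B set by (auto simp: submatrix_def)
    moreover have "submatrix B {k} {k} $$ (0, 0) = B $$ (k, k)"
      using submatrix_index_card[of k B k "{k}" "{k}"] B that
      by (simp cong: conj_cong)
    ultimately show ?thesis by (simp add: det_single)
  qed
  show "0 \<le> B $$ (0, 0)" "0 \<le> B $$ (1, 1)" by (simp_all add: diag)
  have set: "{i. i < 2 \<and> i \<in> {..<2}} = {..<2::nat}" by auto
  have "pick {..<2} i = i" if "i < 2" for i
    using pick_reduce_set[of i 2 UNIV] that by (simp add: pick_UNIV lessThan_def)
  hence "submatrix B {..<2} {..<2} = B"
    using B by (intro eq_matI) (auto simp: submatrix_def set)
  moreover have "0 \<le> det (submatrix B {..<2} {..<2})"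
    using tn B unfolding totally_nonneg_def by (auto simp: lessThan_empty_iff)
  ultimately show "B $$ (0, 1) * B $$ (1, 0) \<le> B $$ (0, 0) * B $$ (1, 1)"
    using det_2[OF B] by simp
qed

text \<open>
  What the increasing and the decreasing class have in common. In \<open>test\<close> the indices \<open>p\<close> and \<open>q\<close> say
  where the smaller and the larger value stand: the order is \<open>(s, t)\<close> for increasing sequences and
  \<open>(t, s)\<close> for decreasing ones.
\<close>

lemma preserver_equivalences:
  fixes C :: "nat \<Rightarrow> real mat set" and f :: "real \<Rightarrow> real"
  assumes psd: "\<And>n A. A \<in> C n \<Longrightarrow> pos_semidef A"
    and tn: "\<And>n A. A \<in> C n \<Longrightarrow> totally_nonneg A"
    and closed: "\<And>n A. (\<forall>t\<ge>0. 0 \<le> f t) \<Longrightarrow> mono_on {0..} f \<Longrightarrow> A \<in> C n \<Longrightarrow> map_mat f A \<in> C n"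
    and test: "\<And>s t. 0 \<le> s \<Longrightarrow> s \<le> t \<Longrightarrow>
      \<exists>a p q. {p, q} = {0, 1} \<and> a p = s \<and> a q = t \<and> min_matrix 2 a a \<in> C 2"
  defines "N \<equiv> (\<forall>t\<ge>0. 0 \<le> f t) \<and> mono_on {0..} f"
  shows "(\<forall>n\<ge>1. \<forall>A\<in>C n. pos_semidef (map_mat f A)) \<longleftrightarrow> N"
    and "(\<forall>n\<ge>1. \<forall>A\<in>C n. totally_nonneg (map_mat f A)) \<longleftrightarrow> N"
    and "(\<forall>n\<ge>1. \<forall>A\<in>C n. map_mat f A \<in> C n) \<longleftrightarrow> N"
proof -
  let ?psd = "\<forall>n\<ge>1. \<forall>A\<in>C n. pos_semidef (map_mat f A)"
  let ?tn = "\<forall>n\<ge>1. \<forall>A\<in>C n. totally_nonneg (map_mat f A)"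
  let ?cls = "\<forall>n\<ge>1. \<forall>A\<in>C n. map_mat f A \<in> C n"
  have N_I: N if "\<And>s t. 0 \<le> s \<Longrightarrow> s \<le> t \<Longrightarrow> 0 \<le> f s \<and> f s \<le> f t"
    using that unfolding N_def by (auto intro!: mono_onI)
  have "N \<Longrightarrow> ?cls" unfolding N_def using closed by blast
  moreover have "?cls \<Longrightarrow> ?psd" "?cls \<Longrightarrow> ?tn" using psd tn by blast+
  moreover have N if ?psd
  proof (rule N_I)
    fix s t :: real assume st: "0 \<le> s" "s \<le> t"
    obtain a p q where a: "{p, q} = {0, 1}" "a p = s" "a q = t" "min_matrix 2 a a \<in> C 2"
      using test[OF st] by blast
    have "pos_semidef (map_mat f (min_matrix 2 a a))" using that[rule_format, OF _ a(4)] by simp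
    from pos_semidef_2[OF _ this] a st show "0 \<le> f s \<and> f s \<le> f t"
      by (auto simp: doubleton_eq_iff min_def split: if_splits)
  qed
  moreover have N if ?tn
  proof (rule N_I)
    fix s t :: real assume st: "0 \<le> s" "s \<le> t"
    obtain a p q where a: "{p, q} = {0, 1}" "a p = s" "a q = t" "min_matrix 2 a a \<in> C 2"
      using test[OF st] by blast
    have "totally_nonneg (map_mat f (min_matrix 2 a a))" using that[rule_format, OF _ a(4)] by simp
    from totally_nonneg_2[OF _ this] a st
    have *: "0 \<le> f s" "0 \<le> f t" "f s * f s \<le> f s * f t"
      by (auto simp: doubleton_eq_iff min_def mult.commute split: if_splits)
    \<comment> \<open>The determinant only gives \<open>f s * (f t - f s) \<ge> 0\<close>; where \<open>f s = 0\<close>, the inequality is \<open>f t \<ge> 0\<close>.\<close>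
    have "f s \<le> f t"
    proof (cases "f s = 0")
      case False
      with * show ?thesis by (simp add: mult_le_cancel_left)
    qed (use * in simp)
    with * show "0 \<le> f s \<and> f s \<le> f t" by simp
  qed
  ultimately show "?psd \<longleftrightarrow> N" "?tn \<longleftrightarrow> N" "?cls \<longleftrightarrow> N" by blast+
qed

theorem theorem3p4:
  fixes f :: "real \<Rightarrow> real"
  shows
    "let psd_min = (\<forall>n\<ge>1. \<forall>A\<in>C_min n. pos_semidef (map_mat f A));
         psd_max = (\<forall>n\<ge>1. \<forall>A\<in>C_max n. pos_semidef (map_mat f A));
         tn_min = (\<forall>n\<ge>1. \<forall>A\<in>C_min n. totally_nonneg (map_mat f A));
         tn_max = (\<forall>n\<ge>1. \<forall>A\<in>C_max n. totally_nonneg (map_mat f A));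
         cls_min = (\<forall>n\<ge>1. \<forall>A\<in>C_min n. map_mat f A \<in> C_min n);
         cls_max = (\<forall>n\<ge>1. \<forall>A\<in>C_max n. map_mat f A \<in> C_max n);
         nonneg_mono = ((\<forall>t\<ge>0. 0 \<le> f t) \<and> mono_on {0..} f)
     in (psd_min \<longleftrightarrow> tn_min) \<and> (tn_min \<longleftrightarrow> cls_min) \<and> (cls_min \<longleftrightarrow> nonneg_mono) \<and>
        (psd_min \<longleftrightarrow> psd_max) \<and> (tn_min \<longleftrightarrow> tn_max) \<and> (cls_min \<longleftrightarrow> cls_max)"
proof -
  have min_test: "\<exists>a p q. {p, q} = {0, 1} \<and> a p = s \<and> a q = t \<and> min_matrix 2 a a \<in> C_min 2"
    if "0 \<le> s" "s \<le> t" for s t :: real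
  proof -
    let ?a = "\<lambda>i::nat. if i = 0 then s else t"
    have "min_matrix 2 ?a ?a \<in> C_min 2"
      using that unfolding C_min_eq_min_matrices by (auto intro!: exI[of _ ?a] mono_onI)
    then show ?thesis by (intro exI[of _ ?a] exI[of _ 0] exI[of _ 1]) auto
  qed
  have max_test: "\<exists>a p q. {p, q} = {0, 1} \<and> a p = s \<and> a q = t \<and> min_matrix 2 a a \<in> C_max 2"
    if "0 \<le> s" "s \<le> t" for s t :: real
  proof -
    let ?a = "\<lambda>i::nat. if i = 0 then t else s"
    have "min_matrix 2 ?a ?a \<in> C_max 2"
      using that unfolding C_max_eq_min_matrices by (auto intro!: exI[of _ ?a] monotone_onI)
    then show ?thesis by (intro exI[of _ ?a] exI[of _ 1] exI[of _ 0]) auto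
  qed
  have min_closed: "map_mat f A \<in> C_min n"
    if f: "\<forall>t\<ge>0. 0 \<le> f t" "mono_on {0..} f" and A: "A \<in> C_min n" for n A
  proof -
    from A obtain a where a: "A = min_matrix n a a" "\<forall>i<n. 0 \<le> a i" "mono_on {..<n} a"
      by (auto simp: C_min_eq_min_matrices)
    have "mono_on {..<n} (f \<circ> a)"
      using f(2) a(3) by (rule monotone_on_o) (use a(2) in auto)
    with a f show ?thesis
      unfolding C_min_eq_min_matrices by (auto simp: map_min_matrix intro!: exI[of _ "f \<circ> a"])
  qed
  have max_closed: "map_mat f A \<in> C_max n"
    if f: "\<forall>t\<ge>0. 0 \<le> f t" "mono_on {0..} f" and A: "A \<in> C_max n" for n A
  proof -
    from A obtain a where a: "A = min_matrix n a a" "\<forall>i<n. 0 \<le> a i" "antimono_on {..<n} a"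
      by (auto simp: C_max_eq_min_matrices)
    have "antimono_on {..<n} (f \<circ> a)"
      \<comment> \<open>Monotone functions also preserve the converse order, in which \<open>a\<close> is monotone.\<close>
      using monotone_on_o[of "{0..}" "(\<ge>)" "(\<ge>)" f "{..<n}" "(\<le>)" a] f(2) a(2,3)
      by (auto simp: monotone_on_def)
    with a f show ?thesis
      unfolding C_max_eq_min_matrices by (auto simp: map_min_matrix intro!: exI[of _ "f \<circ> a"])
  qed
  have min_members: "pos_semidef A" "totally_nonneg A" if "A \<in> C_min n" for n A
    using that unfolding C_min_eq_min_matrices
    by (auto intro: pos_semidef_min_matrix totally_nonneg_min_matrix_mono)
  have max_members: "pos_semidef A" "totally_nonneg A" if "A \<in> C_max n" for n A
    using that unfolding C_max_eq_min_matrices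
    by (auto intro: pos_semidef_min_matrix totally_nonneg_min_matrix_antimono)
  note min = preserver_equivalences[of C_min f, OF min_members min_closed min_test]
  note max = preserver_equivalences[of C_max f, OF max_members max_closed max_test]
  show ?thesis
    unfolding Let_def by (simp only: min max)
qed

end
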